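(* Let $d\in\mathbb N$, $a\in\mathbb N_0$. The generalized Eulerian numbers satisfy $rEu(d,a;0,0)=1$ and, for all $n\ge1$ and $m=0,1,\dots,n$, $$rEu(d,a;n,m)=\big(d\,(n-m)+(d-a)\big)\,rEu(d,a;n-1,m-1)+(a+d\,m)\,rEu(d,a;n-1,m).$$
   Context: $\mathbb N=\{1,2,\dots\}$, $\mathbb N_0=\{0,1,2,\dots\}$, $0^0:=1$. The generalized Stirling numbers of the second kind $S2(d,a;n,m)$, $0\le m\le n$, are defined by the operator identity $(a\,\mathbf 1+d\,\mathbf E_x)^n=\sum_{m=0}^n S2(d,a;n,m)\,x^m\,\mathbf d_x^{\,m}$, where $\mathbf d_x$ is differentiation with respect to $x$, $\mathbf E_x:=x\,\mathbf d_x$ and $\mathbf 1$ is the identity operator. The generalized (row reversed) Eulerian numbers are defined, for $0\le k\le n$, by $rEu(d,a;n,k):=\sum_{j=0}^k(-1)^{k-j}\binom{n-j}{k-j}S2(d,a;n,j)\,j!$; by convention $rEu(d,a;n,-1)=0$ and $rEu(d,a;n,m)=0$ for $n<m$. *)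

theory Defs
  imports Complex_Main "HOL-Computational_Algebra.Formal_Power_Series"
begin

definition euler_op :: "real fps \<Rightarrow> real fps" where
  "euler_op f = fps_X * fps_deriv f"

definition affine_euler_op :: "nat \<Rightarrow> nat \<Rightarrow> real fps \<Rightarrow> real fps" where
  "affine_euler_op d a f = fps_const (real a) * f + fps_const (real d) * euler_op f"

text \<open>
  The operators act on formal power series in \<open>x\<close>. A row of generalized Stirling numbers is
  extended by zero beyond \<open>m = n\<close>, so that the operator identity determines it uniquely;
  see \<open>is_S2_row_ex1\<close> below.
\<close>

definition is_S2_row :: "nat \<Rightarrow> nat \<Rightarrow> nat \<Rightarrow> (nat \<Rightarrow> real) \<Rightarrow> bool" where
  "is_S2_row d a n c \<longleftrightarrow> (\<forall>m>n. c m = 0) \<and>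
     (\<forall>f. (affine_euler_op d a ^^ n) f = (\<Sum>m=0..n. fps_const (c m) * (fps_X ^ m * (fps_deriv ^^ m) f)))"

definition S2 :: "nat \<Rightarrow> nat \<Rightarrow> nat \<Rightarrow> nat \<Rightarrow> real" where
  "S2 d a n = (THE c. is_S2_row d a n c)"

text \<open>The column index is an integer because the value at \<open>-1\<close> is used.\<close>

definition rEu :: "nat \<Rightarrow> nat \<Rightarrow> nat \<Rightarrow> int \<Rightarrow> real" where
  "rEu d a n k =
     (if 0 \<le> k \<and> k \<le> int n
      then (\<Sum>j=0..nat k. (-1) ^ (nat k - j) * real ((n - j) choose (nat k - j)) * S2 d a n j * fact j)
      else 0)"

lemma is_S2_row_unique:
  assumes "is_S2_row d a n c" "is_S2_row d a n c'"
  shows "c = c'"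
proof
  fix k
  let ?e = "fps_exp (1::real)"
  have D: "(fps_deriv ^^ m) ?e = ?e" for m
    by (induction m) simp_all
  have "(\<Sum>m=0..n. fps_const (c m) * (fps_X ^ m * ?e)) = (\<Sum>m=0..n. fps_const (c' m) * (fps_X ^ m * ?e))"
  proof -
    have "(affine_euler_op d a ^^ n) ?e = (\<Sum>m=0..n. fps_const (c m) * (fps_X ^ m * (fps_deriv ^^ m) ?e))"
      using assms(1) unfolding is_S2_row_def by blast
    moreover have "(affine_euler_op d a ^^ n) ?e = (\<Sum>m=0..n. fps_const (c' m) * (fps_X ^ m * (fps_deriv ^^ m) ?e))"
      using assms(2) unfolding is_S2_row_def by blast
    ultimately show ?thesis unfolding D by (rule trans[OF sym])
  qed
  then have "(\<Sum>m=0..n. fps_const (c m) * fps_X ^ m) * ?e = (\<Sum>m=0..n. fps_const (c' m) * fps_X ^ m) * ?e"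
    by (simp add: sum_distrib_right mult.assoc)
  moreover have "?e \<noteq> 0" by simp
  ultimately have "(\<Sum>m=0..n. fps_const (c m) * fps_X ^ m) = (\<Sum>m=0..n. fps_const (c' m) * fps_X ^ m)"
    by simp
  then have "fps_nth (\<Sum>m=0..n. fps_const (c m) * fps_X ^ m) k = fps_nth (\<Sum>m=0..n. fps_const (c' m) * fps_X ^ m) k"
    by simp
  then have "(\<Sum>m=0..n. if k = m then c m else 0) = (\<Sum>m=0..n. if k = m then c' m else 0)"
    by (simp add: fps_sum_nth if_distrib cong: if_cong)
  then have "k \<le> n \<Longrightarrow> c k = c' k" by simp
  moreover have "k > n \<Longrightarrow> c k = c' k" using assms by (simp add: is_S2_row_def)
  ultimately show "c k = c' k" by linarith
qed

lemma affine_euler_op_sum: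
  "affine_euler_op d a (\<Sum>m\<in>A. g m) = (\<Sum>m\<in>A. affine_euler_op d a (g m))"
  by (simp add: affine_euler_op_def euler_op_def fps_deriv_sum sum_distrib_left sum.distrib)

lemma affine_euler_op_term:
  "affine_euler_op d a (fps_const c * (fps_X ^ m * (fps_deriv ^^ m) f)) =
     fps_const ((real a + real d * real m) * c) * (fps_X ^ m * (fps_deriv ^^ m) f) +
     fps_const (real d * c) * (fps_X ^ Suc m * (fps_deriv ^^ Suc m) f)"
proof -
  have "fps_X * fps_deriv (fps_X ^ m) = fps_const (real m) * (fps_X ^ m :: real fps)"
  proof (induction m)
    case (Suc m)
    have "fps_X * fps_deriv (fps_X ^ Suc m) = fps_X * fps_X ^ m + fps_X * (fps_X * fps_deriv (fps_X ^ m :: real fps))"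
      by (simp add: algebra_simps del: fps_deriv_power)
    also have "\<dots> = fps_const (real (Suc m)) * fps_X ^ Suc m"
      unfolding Suc.IH
      by (simp only: of_nat_Suc fps_const_add[symmetric] fps_const_1_eq_1 power_Suc mult_1 algebra_simps)
    finally show ?case .
  qed simp
  then have *: "euler_op (fps_X ^ m * (fps_deriv ^^ m) f) =
      fps_const (real m) * (fps_X ^ m * (fps_deriv ^^ m) f) + fps_X ^ Suc m * (fps_deriv ^^ Suc m) f"
    by (simp add: euler_op_def algebra_simps)
  have "euler_op (fps_const c * g) = fps_const c * euler_op g" for g
    by (simp add: euler_op_def algebra_simps)
  note ** = this
  show ?thesis
    unfolding affine_euler_op_def ** *
    by (simp only: fps_const_mult[symmetric] fps_const_add[symmetric] algebra_simps)
qed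

lemma is_S2_row_exists: "\<exists>c. is_S2_row d a n c"
proof (induction n)
  case 0
  show ?case
    by (rule exI[of _ "\<lambda>m. if m = 0 then 1 else 0"]) (simp add: is_S2_row_def)
next
  case (Suc n)
  then obtain c where c0: "\<And>m. m > n \<Longrightarrow> c m = 0"
    and c: "\<And>f. (affine_euler_op d a ^^ n) f = (\<Sum>m=0..n. fps_const (c m) * (fps_X ^ m * (fps_deriv ^^ m) f))"
    by (auto simp: is_S2_row_def)
  define b where "b m = real d * (if m = 0 then 0 else c (m - 1))" for m
  define e where "e m = (real a + real d * real m) * c m + b m" for m
  have "(affine_euler_op d a ^^ Suc n) f = (\<Sum>m=0..Suc n. fps_const (e m) * (fps_X ^ m * (fps_deriv ^^ m) f))" for f
  proof -
    define t where "t m = fps_X ^ m * (fps_deriv ^^ m) f" for m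
    have "(affine_euler_op d a ^^ Suc n) f =
      (\<Sum>m=0..n. fps_const ((real a + real d * real m) * c m) * t m) + (\<Sum>m=0..n. fps_const (real d * c m) * t (Suc m))"
      by (simp only: funpow.simps o_apply c affine_euler_op_sum affine_euler_op_term sum.distrib t_def)
    also have "(\<Sum>m=0..n. fps_const ((real a + real d * real m) * c m) * t m) =
        (\<Sum>m=0..Suc n. fps_const ((real a + real d * real m) * c m) * t m)"
      by (simp add: c0)
    also have "(\<Sum>m=0..n. fps_const (real d * c m) * t (Suc m)) = (\<Sum>m=0..Suc n. fps_const (b m) * t m)"
      by (simp add: sum.atLeast0_atMost_Suc_shift b_def del: sum.atLeast0_atMost_Suc sum.cl_ivl_Suc)
    also have "(\<Sum>m=0..Suc n. fps_const ((real a + real d * real m) * c m) * t m) + (\<Sum>m=0..Suc n. fps_const (b m) * t m)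
       = (\<Sum>m=0..Suc n. fps_const (e m) * t m)"
      unfolding e_def sum.distrib[symmetric] fps_const_add[symmetric] distrib_right ..
    finally show ?thesis by (simp add: t_def)
  qed
  moreover have "e m = 0" if "m > Suc n" for m
    using that by (simp add: e_def b_def c0)
  ultimately show ?case unfolding is_S2_row_def by blast
qed

lemma is_S2_row_ex1: "\<exists>!c. is_S2_row d a n c"
  using is_S2_row_exists is_S2_row_unique by blast

end

(* On the exponential series the operator a + d E acts by e^x P \<mapsto> e^x (a P + d x (P + P')), and the
   n-th power of the operator applied to e^x is e^x times the row polynomial of S2.  This gives the
   triangular recurrence of S2; the recurrence of rEu follows by comparing the coefficients of
   S2(n, j) j!, using Pascal's rule and i C(N, i) = (N + 1 - i) C(N, i - 1). *)
theory Submission imports Defs begin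

lemma is_S2_row_S2: "is_S2_row d a n (S2 d a n)"
  unfolding S2_def by (rule theI'[OF is_S2_row_ex1])

lemma S2_eq_0: "m > n \<Longrightarrow> S2 d a n m = 0"
  using is_S2_row_S2 by (simp add: is_S2_row_def)

lemma affine_euler_op_funpow_exp:
  "(affine_euler_op d a ^^ n) (fps_exp 1) = Abs_fps (S2 d a n) * fps_exp 1"
proof -
  have D: "(fps_deriv ^^ m) (fps_exp 1) = (fps_exp 1 :: real fps)" for m
    by (induction m) simp_all
  have "(affine_euler_op d a ^^ n) (fps_exp 1) =
      (\<Sum>m=0..n. fps_const (S2 d a n m) * (fps_X ^ m * (fps_deriv ^^ m) (fps_exp 1)))"
    using is_S2_row_S2[of d a n] unfolding is_S2_row_def by blast
  also have "\<dots> = (\<Sum>m=0..n. fps_const (S2 d a n m) * fps_X ^ m) * fps_exp 1"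
    unfolding D by (simp add: sum_distrib_right mult.assoc)
  \<comment> \<open>Since \<open>S2 d a n\<close> vanishes beyond \<open>n\<close>, its row
    polynomial is its full generating series.\<close>
  also have "(\<Sum>m=0..n. fps_const (S2 d a n m) * fps_X ^ m) = Abs_fps (S2 d a n)"
    by (rule fps_ext) (auto simp: fps_sum_nth if_distrib S2_eq_0 cong: if_cong)
  finally show ?thesis .
qed

lemma affine_euler_op_mult_exp:
  "affine_euler_op d a (P * fps_exp 1) =
     (fps_const (real a) * P + fps_const (real d) * (fps_X * (P + fps_deriv P))) * fps_exp 1"
  by (simp add: affine_euler_op_def euler_op_def algebra_simps)

lemma S2_0_0: "S2 d a 0 0 = 1"
proof -
  have "Abs_fps (S2 d a 0) * fps_exp 1 = 1 * fps_exp 1"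
    using affine_euler_op_funpow_exp[of 0 d a] by simp
  then have "Abs_fps (S2 d a 0) = 1"
    unfolding mult_cancel_right by simp
  then show ?thesis
    by (metis fps_nth_Abs_fps fps_one_nth)
qed

text \<open>Cancelling the nonzero factor \<open>fps_exp 1\<close> leaves an identity between
  generating series of consecutive rows; its coefficient at \<open>m\<close> is the
  recurrence.\<close>

lemma S2_Suc:
  "S2 d a (Suc n) m =
     (real a + real d * real m) * S2 d a n m + (if m = 0 then 0 else real d * S2 d a n (m - 1))"
proof -
  let ?P = "Abs_fps (S2 d a n)"
  have "Abs_fps (S2 d a (Suc n)) * fps_exp 1 =
      (fps_const (real a) * ?P + fps_const (real d) * (fps_X * (?P + fps_deriv ?P))) * fps_exp 1"
    using affine_euler_op_funpow_exp[of "Suc n" d a]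
    by (simp only: funpow.simps o_apply affine_euler_op_funpow_exp affine_euler_op_mult_exp)
  then have "Abs_fps (S2 d a (Suc n)) =
      fps_const (real a) * ?P + fps_const (real d) * (fps_X * (?P + fps_deriv ?P))"
    unfolding mult_cancel_right by simp
  from arg_cong[where f = "\<lambda>f. fps_nth f m", OF this] show ?thesis
    by (cases m) (simp_all add: algebra_simps)
qed

text \<open>The sum also gives the conventional value 0 for \<open>k > n\<close>: the binomial
  vanishes for \<open>j \<le> n\<close>, and \<open>S2 d a n j\<close> does for
  \<open>j > n\<close>. This spares the recurrence a separate case at its upper boundary.\<close>

lemma rEu_int:
  "rEu d a n (int k) =
     (\<Sum>j=0..k. (-1) ^ (k - j) * real ((n - j) choose (k - j)) * (S2 d a n j * fact j))"
proof (cases "k \<le> n")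
  case True
  then show ?thesis by (simp add: rEu_def mult.assoc)
next
  case False
  have "real ((n - j) choose (k - j)) * S2 d a n j = 0" for j
    using False by (cases "j \<le> n") (simp_all add: S2_eq_0 binomial_eq_0)
  then have "(\<Sum>j=0..k. (-1) ^ (k - j) * real ((n - j) choose (k - j)) * (S2 d a n j * fact j)) = 0"
    by (intro sum.neutral) auto
  with False show ?thesis by (simp add: rEu_def)
qed

text \<open>Real subtraction keeps this valid for \<open>i > N\<close>, where both binomials are
  0.\<close>

lemma Suc_times_binomial_Suc_real:
  "real (Suc i) * real (N choose Suc i) = (real N - real i) * real (N choose i)"
proof (cases "i \<le> N")
  case True
  have "Suc i * (N choose Suc i) = (N - i) * (N choose i)"
    using binomial_absorb_comp[of N i] binomial_absorption[of i N] by simp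
  then have "real (Suc i * (N choose Suc i)) = real ((N - i) * (N choose i))"
    by (rule arg_cong)
  then show ?thesis
    using True by (simp only: of_nat_mult of_nat_diff)
qed (simp add: binomial_eq_0)

lemma rEu_Suc_0: "rEu d a (Suc n) 0 = real a * rEu d a n 0"
  using rEu_int[of d a "Suc n" 0] rEu_int[of d a n 0] by (simp add: S2_Suc)

lemma rEu_Suc_Suc:
  "rEu d a (Suc n) (int (Suc k)) =
     (real d * (real n - real k) + (real d - real a)) * rEu d a n (int k)
     + (real a + real d * real (Suc k)) * rEu d a n (int (Suc k))"
proof -
  define T where "T j = S2 d a n j * fact j" for j
  define s where "s j = ((-1) ^ (k - j) :: real)" for j
  have T0: "T j = 0" if "j > n" for j
    using that by (simp add: T_def S2_eq_0)
  let ?L = "\<lambda>j. (-1) ^ (Suc k - j) * real ((Suc n - j) choose (Suc k - j))"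
  let ?R = "\<lambda>j. (-1) ^ (Suc k - j) * real ((n - j) choose (Suc k - j))"
  \<comment> \<open>The factor \<open>real j\<close> comes from
    \<open>fact j = j * fact (j - 1)\<close>.\<close>
  have S2_fact_Suc: "S2 d a (Suc n) j * fact j =
      (real a + real d * real j) * T j + (if j = 0 then 0 else real d * real j * T (j - 1))" for j
    by (cases j) (simp_all add: S2_Suc T_def algebra_simps)
  \<comment> \<open>Both sides collect what multiplies \<open>T j\<close> in the claim, once the sum
    over \<open>T (j - 1)\<close> is shifted by one.\<close>
  have coeff: "?L j * ((real a + real d * real j) * T j)
        + s j * real ((n - j) choose (k - j)) * (real d * real (Suc j) * T j) =
      (real d * (real n - real k) + (real d - real a)) * (s j * real ((n - j) choose (k - j)) * T j)
        + (real a + real d * real (Suc k)) * (?R j * T j)" if "j \<le> k" for j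
  proof (cases "j \<le> n")
    case True
    define N i where "N = n - j" and "i = k - j"
    have n: "n = N + j" and k: "k = i + j"
      using True that by (simp_all add: N_def i_def)
    define A B where "A = real (N choose i)" and "B = real (N choose Suc i)"
    have B: "real i * B = (real N - real i) * A - B"
      using Suc_times_binomial_Suc_real[of i N] unfolding A_def B_def by (simp add: algebra_simps)
    have sign: "(-1) ^ (Suc k - j) = - s j"
      using that by (simp add: s_def Suc_diff_le)
    have choose: "real ((n - j) choose (k - j)) = A" "real ((n - j) choose (Suc k - j)) = B"
      "real ((Suc n - j) choose (Suc k - j)) = A + B"
      by (simp_all add: n k A_def B_def Suc_diff_le)
    \<comment> \<open>After expansion the products of \<open>j\<close> with \<open>A\<close> cancel;
      what remains is \<open>d\<close> times the relation \<open>B\<close>.\<close>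
    have "- (A + B) * (real a + real d * real j) + A * (real d * real (Suc j)) =
        (real d * (real n - real k) + (real d - real a)) * A
        - (real a + real d * real (Suc k)) * B"
    proof -
      have "real d * (real i * B) = real d * ((real N - real i) * A - B)"
        by (simp only: B)
      then show ?thesis
        unfolding n k by (simp add: algebra_simps)
    qed
    from arg_cong[where f = "\<lambda>x. s j * T j * x", OF this] show ?thesis
      unfolding sign choose by (simp add: algebra_simps)
  qed (simp add: T0)
  have "rEu d a (Suc n) (int (Suc k)) =
      (\<Sum>j=0..Suc k. ?L j * ((real a + real d * real j) * T j))
      + (\<Sum>j=0..Suc k. ?L j * (if j = 0 then 0 else real d * real j * T (j - 1)))"
    unfolding rEu_int S2_fact_Suc distrib_left sum.distrib ..
  \<comment> \<open>The zero term drops out, and the shift lowers both \<open>Suc n - j\<close> and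
    \<open>Suc k - j\<close> by one.\<close>
  also have "(\<Sum>j=0..Suc k. ?L j * (if j = 0 then 0 else real d * real j * T (j - 1))) =
      (\<Sum>j=0..k. s j * real ((n - j) choose (k - j)) * (real d * real (Suc j) * T j))"
    by (simp add: sum.atLeast0_atMost_Suc_shift s_def del: sum.atLeast0_atMost_Suc sum.cl_ivl_Suc)
  \<comment> \<open>The term \<open>j = Suc k\<close> has no partner in the shifted sum; its sign
    and binomial are both 1.\<close>
  also have "(\<Sum>j=0..Suc k. ?L j * ((real a + real d * real j) * T j)) + \<dots> =
      (\<Sum>j=0..k. ?L j * ((real a + real d * real j) * T j)
        + s j * real ((n - j) choose (k - j)) * (real d * real (Suc j) * T j))
      + (real a + real d * real (Suc k)) * T (Suc k)"
    by (simp add: sum.distrib)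
  also have "\<dots> = (\<Sum>j=0..k.
        (real d * (real n - real k) + (real d - real a)) * (s j * real ((n - j) choose (k - j)) * T j)
        + (real a + real d * real (Suc k)) * (?R j * T j))
      + (real a + real d * real (Suc k)) * T (Suc k)"
    by (intro arg_cong2[where f = "(+)"] sum.cong refl coeff) simp
  \<comment> \<open>The separate term is absorbed as the last summand of the sum over
    \<open>?R\<close>.\<close>
  also have "\<dots> = (real d * (real n - real k) + (real d - real a)) *
        (\<Sum>j=0..k. s j * real ((n - j) choose (k - j)) * T j)
      + (real a + real d * real (Suc k)) * (\<Sum>j=0..Suc k. ?R j * T j)"
    by (simp add: sum.distrib sum_distrib_left distrib_left)
  finally show ?thesis
    unfolding rEu_int T_def s_def .
qed

theorem mainTheorem11:
  fixes d a :: nat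
  assumes "d \<ge> 1"
  shows "rEu d a 0 0 = 1 \<and>
    (\<forall>n m :: nat. n \<ge> 1 \<longrightarrow> m \<le> n \<longrightarrow>
       rEu d a n (int m) =
         (real d * (real n - real m) + (real d - real a)) * rEu d a (n - 1) (int m - 1)
         + (real a + real d * real m) * rEu d a (n - 1) (int m))"
proof (intro conjI allI impI)
  show "rEu d a 0 0 = 1"
    by (simp add: rEu_def S2_0_0)
next
  fix n m :: nat
  assume "n \<ge> 1" "m \<le> n"
  then obtain n' where n: "n = Suc n'"
    by (cases n) auto
  show "rEu d a n (int m) =
      (real d * (real n - real m) + (real d - real a)) * rEu d a (n - 1) (int m - 1)
      + (real a + real d * real m) * rEu d a (n - 1) (int m)"
  proof (cases m)
    case 0
    \<comment> \<open>In column 0 the convention at index -1 removes the first summand.\<close>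
    have "rEu d a n' (-1) = 0"
      by (simp add: rEu_def)
    then show ?thesis
      using 0 by (simp add: n rEu_Suc_0)
  next
    case (Suc k)
    then show ?thesis
      using rEu_Suc_Suc[of d a n' k] by (simp add: n)
  qed
qed

end
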